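(* Let $\mathcal{V}$ be a $d$-dimensional linear subspace of $\mathbb{R}^m$ equipped with the scalar product $(x,y)_A=\langle x,Ay\rangle$, where $A$ is a diagonal positive $m\times m$-matrix, and let $c:[0,\infty)\to\mathcal{V}$ be Lipschitz continuous. Let $c_j^-,c_j^+\in\mathbb{R}$ ($j=1,\dots,m$), and for $\alpha\in\{-1,1\}$ put $$L(\alpha,j)=\{y\in\mathcal{V}:\langle\alpha e_j,Ay\rangle\le\alpha c_j^\alpha\},\quad \overline{\overline L}(\alpha,j)=\{y\in\mathcal{V}:\langle e_j,Ay\rangle=c_j^\alpha\},$$ $$C=\bigcap_{j=1}^m\big(L(-1,j)\cap L(1,j)\big),\qquad C(t)=C+c(t).$$ Let $M\ge1$, let $I_0,I_1,\dots,I_M\subset\{-1,1\}\times\{1,\dots,m\}$, and let $$F=\Big(\bigcap_{(\alpha,j)\in I_0}\overline{\overline L}(\alpha,j)\Big)\cap\Big(\bigcap_{i=1}^M\bigcap_{(\alpha,j)\in I_i}L(\alpha,j)\Big),\qquad F(t)=F+c(t).$$ Assume: (1) for each $i\in\{1,\dots,M\}$ the set $\bigcap_{(\alpha,j)\in I_0\cup I_i}\overline{\overline L}(\alpha,j)$ is a singleton $\{y_{*,i}\}$, with $y_{*,i}\in F$; (2) for each $y\in F$ there is a (possibly empty) set $J_y\subset\{1,\dots,M\}$ such that $\{(\alpha,j):y\in\overline{\overline L}(\alpha,j)\}=I_0\cup\bigcap_{i\in J_y}I_i$; (3) for each $i\in\{1,\dots,M\}$ one has $J_{y_{*,i}}=\{i\}$,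 i.e. $\{(\alpha,j):y_{*,i}\in\overline{\overline L}(\alpha,j)\}=I_0\cup I_i$; (4) $F\subset C$. If there exists $\varepsilon>0$ such that $$-c'(t)+B^A_\varepsilon(0)\cap N^A_F(y_{*,i})\subset N^A_C(y_{*,i})\quad\text{for a.a. }t\in[0,\tau_d]\text{ and all } i\in\{1,\dots,M\},$$ where $\tau_d=\frac1\varepsilon\max_{v\in C,\ i\in\{1,\dots,M\}}\|v-y_{*,i}\|^A$, then every solution $y$ of the sweeping process $-\dot y(t)\in N^A_{C(t)}(y(t))$ with initial condition $y(0)\in C(0)$ satisfies $y(\tau_d)\in F(\tau_d)$.
   Context: $\langle\cdot,\cdot\rangle$ is the Euclidean scalar product and $e_j$ the standard basis of $\mathbb{R}^m$; $c_j^{\alpha}$ means $c_j^+$ for $\alpha=1$ and $c_j^-$ for $\alpha=-1$. In (2), the intersection over $J_y=\emptyset$ is understood as the empty set (so the right-hand side is $I_0$). $\|x\|^A=\sqrt{\langle x,Ax\rangle}$; $B^A_\varepsilon(0)=\{x\in\mathcal{V}:\|x\|^A\le\varepsilon\}$. For a closed convex $K\subset\mathcal{V}$: $N^A_K(y)=\{x\in\mathcal{V}:\langle x,A(\xi-y)\rangle\le 0\ \forall\xi\in K\}$ if $y\in K$, and $\emptyset$ otherwise. A solution of the sweeping process is a locally absolutely continuous function $y:[0,\infty)\to\mathcal{V}$ with $y(t)\in C(t)$ for all $t$ satisfying the inclusion for almost every $t$. *)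

theory Defs
  imports "HOL-Analysis.Analysis"
begin

definition absolutely_cont_on :: "real set \<Rightarrow> (real \<Rightarrow> 'a::metric_space) \<Rightarrow> bool" where
  "absolutely_cont_on S f \<longleftrightarrow>
    (\<forall>e>0. \<exists>\<delta>>0. \<forall>(n::nat) a b.
       (\<forall>k<n. a k \<le> b k \<and> {a k..b k} \<subseteq> S) \<and>
       disjoint_family_on (\<lambda>k. {a k<..<b k}) {..<n} \<and>
       (\<Sum>k<n. b k - a k) < \<delta>
       \<longrightarrow> (\<Sum>k<n. dist (f (b k)) (f (a k))) < e)"

definition locally_absolutely_cont_on :: "real set \<Rightarrow> (real \<Rightarrow> 'a::metric_space) \<Rightarrow> bool" where
  "locally_absolutely_cont_on S f \<longleftrightarrow>
    (\<forall>a b. {a..b} \<subseteq> S \<longrightarrow> absolutely_cont_on {a..b} f)"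

definition normA :: "real^'m^'m \<Rightarrow> real^'m \<Rightarrow> real" where
  "normA A x = sqrt (x \<bullet> (A *v x))"

definition cballA :: "(real^'m) set \<Rightarrow> real^'m^'m \<Rightarrow> real \<Rightarrow> (real^'m) set" where
  "cballA V A \<epsilon> = {x \<in> V. normA A x \<le> \<epsilon>}"

definition normal_coneA ::
  "(real^'m) set \<Rightarrow> real^'m^'m \<Rightarrow> (real^'m) set \<Rightarrow> real^'m \<Rightarrow> (real^'m) set" where
  "normal_coneA V A K y =
    (if y \<in> K then {x \<in> V. \<forall>\<xi>\<in>K. x \<bullet> (A *v (\<xi> - y)) \<le> 0} else {})"

definition translate_by :: "(real^'m) set \<Rightarrow> (real \<Rightarrow> real^'m) \<Rightarrow> real \<Rightarrow> (real^'m) set" where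
  "translate_by K c t = (\<lambda>x. x + c t) ` K"

text \<open>The differential inclusion is stated for an existing derivative at almost every \<open>t\<close>, avoiding the
  junk value of \<open>vector_derivative\<close>; a locally absolutely continuous \<open>y\<close> is differentiable
  almost everywhere, so this adds no restriction.\<close>

definition sweeping_solution ::
  "(real^'m) set \<Rightarrow> real^'m^'m \<Rightarrow> (real \<Rightarrow> (real^'m) set) \<Rightarrow> (real \<Rightarrow> real^'m) \<Rightarrow> bool" where
  "sweeping_solution V A Ct y \<longleftrightarrow>
    locally_absolutely_cont_on {0..} y \<and>
    (\<forall>t\<ge>0. y t \<in> V \<and> y t \<in> Ct t) \<and>
    (AE t in lebesgue. 0 \<le> t \<longrightarrow>
       (\<exists>D. (y has_vector_derivative D) (at t) \<and> - D \<in> normal_coneA V A (Ct t) (y t)))"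

text \<open>The index \<open>\<alpha>\<close> below ranges over \<open>{-1, 1}\<close>; \<open>cm\<close> and \<open>cp\<close> are the families of
  lower and upper bounds.\<close>

definition bound :: "('m \<Rightarrow> real) \<Rightarrow> ('m \<Rightarrow> real) \<Rightarrow> int \<Rightarrow> 'm \<Rightarrow> real" where
  "bound cm cp \<alpha> j = (if \<alpha> = 1 then cp j else cm j)"

definition halfspace_L ::
  "(real^'m) set \<Rightarrow> real^'m^'m \<Rightarrow> ('m \<Rightarrow> real) \<Rightarrow> ('m \<Rightarrow> real) \<Rightarrow> int \<Rightarrow> 'm \<Rightarrow> (real^'m) set" where
  "halfspace_L V A cm cp \<alpha> j =
    {y \<in> V. (of_int \<alpha> *\<^sub>R axis j 1) \<bullet> (A *v y) \<le> of_int \<alpha> * bound cm cp \<alpha> j}"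

definition hyperplane_L ::
  "(real^'m) set \<Rightarrow> real^'m^'m \<Rightarrow> ('m \<Rightarrow> real) \<Rightarrow> ('m \<Rightarrow> real) \<Rightarrow> int \<Rightarrow> 'm \<Rightarrow> (real^'m) set" where
  "hyperplane_L V A cm cp \<alpha> j = {y \<in> V. axis j 1 \<bullet> (A *v y) = bound cm cp \<alpha> j}"

definition set_C ::
  "(real^'m) set \<Rightarrow> real^'m^'m \<Rightarrow> ('m \<Rightarrow> real) \<Rightarrow> ('m \<Rightarrow> real) \<Rightarrow> (real^'m) set" where
  "set_C V A cm cp = (\<Inter>j. halfspace_L V A cm cp (-1) j \<inter> halfspace_L V A cm cp 1 j)"

text \<open>Intersections of subsets of \<open>V\<close> are taken inside \<open>V\<close>: an intersection over an
  empty index set is \<open>V\<close>, not the whole space.\<close>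

definition hyperplanes_meet ::
  "(real^'m) set \<Rightarrow> real^'m^'m \<Rightarrow> ('m \<Rightarrow> real) \<Rightarrow> ('m \<Rightarrow> real) \<Rightarrow> (int \<times> 'm) set \<Rightarrow> (real^'m) set" where
  "hyperplanes_meet V A cm cp S = V \<inter> (\<Inter>(\<alpha>, j)\<in>S. hyperplane_L V A cm cp \<alpha> j)"

definition set_F ::
  "(real^'m) set \<Rightarrow> real^'m^'m \<Rightarrow> ('m \<Rightarrow> real) \<Rightarrow> ('m \<Rightarrow> real) \<Rightarrow>
   nat \<Rightarrow> (nat \<Rightarrow> (int \<times> 'm) set) \<Rightarrow> (real^'m) set" where
  "set_F V A cm cp M I =
    V \<inter> (\<Inter>(\<alpha>, j)\<in>I 0. hyperplane_L V A cm cp \<alpha> j) \<inter>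
        (\<Inter>i\<in>{1..M}. \<Inter>(\<alpha>, j)\<in>I i. halfspace_L V A cm cp \<alpha> j)"

definition active_set ::
  "(real^'m) set \<Rightarrow> real^'m^'m \<Rightarrow> ('m \<Rightarrow> real) \<Rightarrow> ('m \<Rightarrow> real) \<Rightarrow> real^'m \<Rightarrow> (int \<times> 'm) set" where
  "active_set V A cm cp y = {(\<alpha>, j). \<alpha> \<in> {-1, 1} \<and> y \<in> hyperplane_L V A cm cp \<alpha> j}"

text \<open>\<open>represents_active \<dots> J y\<close>: the set \<open>J\<close> is an admissible choice of \<open>J\<^sub>y\<close>.  The intersection
  over \<open>J = {}\<close> is read as the empty set.\<close>

definition represents_active ::
  "(real^'m) set \<Rightarrow> real^'m^'m \<Rightarrow> ('m \<Rightarrow> real) \<Rightarrow> ('m \<Rightarrow> real) \<Rightarrow>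
   nat \<Rightarrow> (nat \<Rightarrow> (int \<times> 'm) set) \<Rightarrow> nat set \<Rightarrow> real^'m \<Rightarrow> bool" where
  "represents_active V A cm cp M I J y \<longleftrightarrow>
    J \<subseteq> {1..M} \<and>
    active_set V A cm cp y = I 0 \<union> (if J = {} then {} else \<Inter>i\<in>J. I i)"

text \<open>Positivity of \<open>A\<close> makes \<open>C\<close> compact, so whenever \<open>C\<close> is nonempty and \<open>M \<ge> 1\<close> the
  supremum is the maximum over \<open>v \<in> C\<close> and \<open>1 \<le> i \<le> M\<close>.\<close>

definition tau_d ::
  "real^'m^'m \<Rightarrow> (real^'m) set \<Rightarrow> nat \<Rightarrow> (nat \<Rightarrow> real^'m) \<Rightarrow> real \<Rightarrow> real" where
  "tau_d A C M ystar \<epsilon> = 1 / \<epsilon> * (SUP (v, i)\<in>C \<times> {1..M}. normA A (v - ystar i))"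

end

theory Submission
  imports Defs
begin

text \<open>Put \<open>z = y - c\<close> and let \<open>p\<close> be the \<open>A\<close>-projection of \<open>z\<close> onto \<open>F\<close>.  By (1) and (2) every
  extreme point of the polytope \<open>F\<close> is some \<open>ystar i\<close>, so \<open>p\<close> is a convex combination of those
  \<open>ystar i\<close> that maximise \<open>(z - p) \<bullet> (A *v _)\<close> over \<open>F\<close>.  At each of these, \<open>n = \<epsilon> (z - p) / |z - p|\<close> is
  an admissible perturbation, hence \<open>n - c' \<in> N\<^sub>C(p)\<close>; adding the inequality for \<open>- y' \<in> N\<^sub>C(z)\<close>
  shows that \<open>|z - p|\<close> decreases at rate at least \<open>\<epsilon>\<close> as long as it is positive.\<close>

section \<open>Absolutely continuous functions\<close>

text \<open>The error \<open>e\<close> is split in half, one half for the increments of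
  \<open>f\<close> and one for the total length. The lemma serves to carry absolute continuity from
  the solution to the distance function and its tilted version.\<close>

lemma absolutely_cont_on_le:
  fixes f :: "real \<Rightarrow> 'a::metric_space" and g :: "real \<Rightarrow> 'b::metric_space"
  assumes f: "absolutely_cont_on S f"
    and le: "\<And>u v. u \<in> S \<Longrightarrow> v \<in> S \<Longrightarrow> u \<le> v \<Longrightarrow>
      dist (g v) (g u) \<le> k * dist (f v) (f u) + l * (v - u)"
  shows "absolutely_cont_on S g"
  unfolding absolutely_cont_on_def
proof (intro allI impI)
  fix e :: real assume "e > 0"
  \<comment> \<open>Enlarging both constants to at least 1 keeps the bound valid and makes division
    by them legitimate.\<close>
  define k' where "k' = max k 1"
  define l' where "l' = max l 1"
  have pos: "k' > 0" "l' > 0" and kl: "k \<le> k'" "l \<le> l'"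
    by (auto simp: k'_def l'_def)
  have "e / (2 * k') > 0"
    using \<open>e > 0\<close> pos by simp
  then obtain d where "d > 0" and d: "\<And>(n::nat) a b.
      (\<forall>i<n. a i \<le> b i \<and> {a i..b i} \<subseteq> S) \<and>
      disjoint_family_on (\<lambda>i. {a i<..<b i}) {..<n} \<and> (\<Sum>i<n. b i - a i) < d \<Longrightarrow>
      (\<Sum>i<n. dist (f (b i)) (f (a i))) < e / (2 * k')"
    using f unfolding absolutely_cont_on_def by meson
  show "\<exists>\<delta>>0. \<forall>(n::nat) a b.
      (\<forall>i<n. a i \<le> b i \<and> {a i..b i} \<subseteq> S) \<and>
      disjoint_family_on (\<lambda>i. {a i<..<b i}) {..<n} \<and> (\<Sum>i<n. b i - a i) < \<delta> \<longrightarrow>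
      (\<Sum>i<n. dist (g (b i)) (g (a i))) < e"
  proof (intro exI[of _ "min d (e / (2 * l'))"] conjI allI impI)
    show "min d (e / (2 * l')) > 0"
      using \<open>d > 0\<close> \<open>e > 0\<close> pos by simp
    fix n :: nat and a b :: "nat \<Rightarrow> real"
    assume A: "(\<forall>i<n. a i \<le> b i \<and> {a i..b i} \<subseteq> S) \<and>
      disjoint_family_on (\<lambda>i. {a i<..<b i}) {..<n} \<and>
      (\<Sum>i<n. b i - a i) < min d (e / (2 * l'))"
    have "(\<Sum>i<n. dist (g (b i)) (g (a i)))
        \<le> (\<Sum>i<n. k' * dist (f (b i)) (f (a i)) + l' * (b i - a i))"
    proof (rule sum_mono)
      fix i assume "i \<in> {..<n}"
      then have i: "a i \<le> b i" "{a i..b i} \<subseteq> S" using A by auto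
      then have "a i \<in> S" "b i \<in> S" by auto
      then have "dist (g (b i)) (g (a i)) \<le> k * dist (f (b i)) (f (a i)) + l * (b i - a i)"
        using le i by blast
      also have "\<dots> \<le> k' * dist (f (b i)) (f (a i)) + l' * (b i - a i)"
        using kl i by (intro add_mono mult_right_mono) auto
      finally show "dist (g (b i)) (g (a i)) \<le> k' * dist (f (b i)) (f (a i)) + l' * (b i - a i)" .
    qed
    also have "\<dots> = k' * (\<Sum>i<n. dist (f (b i)) (f (a i))) + l' * (\<Sum>i<n. b i - a i)"
      by (simp add: sum.distrib sum_distrib_left)
    also have "\<dots> < k' * (e / (2 * k')) + l' * (e / (2 * l'))"
      using d[of n a b] A pos by (intro add_strict_mono mult_strict_left_mono) auto
    also have "\<dots> = e" using pos by simp
    finally show "(\<Sum>i<n. dist (g (b i)) (g (a i))) < e" .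
  qed
qed

text \<open>The definition numbers the intervals by an initial segment of \<open>nat\<close>. A
  bijection with that segment frees the index set, so that the pieces of a tagged division can serve
  as indices.\<close>

lemma absolutely_cont_on_sum_le:
  fixes f :: "real \<Rightarrow> 'a::metric_space"
  assumes f: "absolutely_cont_on S f" and "e > 0"
  obtains d where "d > 0" and
    "\<And>(P :: 'b set) a b. finite P \<Longrightarrow>
      (\<And>i. i \<in> P \<Longrightarrow> a i \<le> b i \<and> {a i..b i} \<subseteq> S) \<Longrightarrow>
      disjoint_family_on (\<lambda>i. {a i<..<b i}) P \<Longrightarrow>
      (\<Sum>i\<in>P. b i - a i) < d \<Longrightarrow> (\<Sum>i\<in>P. dist (f (b i)) (f (a i))) < e"
proof -
  obtain d where "d > 0" and d: "\<And>(n::nat) a b.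
      (\<forall>i<n. a i \<le> b i \<and> {a i..b i} \<subseteq> S) \<and>
      disjoint_family_on (\<lambda>i. {a i<..<b i}) {..<n} \<and> (\<Sum>i<n. b i - a i) < d \<Longrightarrow>
      (\<Sum>i<n. dist (f (b i)) (f (a i))) < e"
    using assms unfolding absolutely_cont_on_def by meson
  show thesis
  proof
    fix P :: "'b set" and a b
    assume "finite P" and ab: "\<And>i. i \<in> P \<Longrightarrow> a i \<le> b i \<and> {a i..b i} \<subseteq> S"
      and disj: "disjoint_family_on (\<lambda>i. {a i<..<b i}) P" and small: "(\<Sum>i\<in>P. b i - a i) < d"
    from ex_bij_betw_nat_finite[OF \<open>finite P\<close>]
    obtain h where h: "bij_betw h {..<card P} P"
      by (auto simp: atLeast0LessThan)
    have "(\<Sum>i<card P. dist (f (b (h i))) (f (a (h i)))) < e"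
    proof (rule d[of "card P" "a \<circ> h" "b \<circ> h", simplified], intro conjI)
      show "\<forall>i<card P. a (h i) \<le> b (h i) \<and> {a (h i)..b (h i)} \<subseteq> S"
        using ab h by (auto dest!: bij_betwE)
      show "disjoint_family_on (\<lambda>i. {a (h i)<..<b (h i)}) {..<card P}"
        using disj h unfolding disjoint_family_on_def bij_betw_def inj_on_def by blast
      show "(\<Sum>i<card P. b (h i) - a (h i)) < d"
        using small sum.reindex_bij_betw[OF h, of "\<lambda>i. b i - a i"] by simp
    qed
    then show "(\<Sum>i\<in>P. dist (f (b i)) (f (a i))) < e"
      using sum.reindex_bij_betw[OF h, of "\<lambda>i. dist (f (b i)) (f (a i))"] by simp
  qed (fact \<open>d > 0\<close>)
qed

text \<open>Outer regularity makes \<open>U - N\<close> small, and adding the null set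
  \<open>N\<close> back does not change the measure.\<close>

lemma negligible_outer_open:
  fixes N :: "'a::euclidean_space set"
  assumes "negligible N" "e > 0"
  obtains U where "open U" "N \<subseteq> U" "emeasure lebesgue U < ennreal e"
proof -
  have N: "N \<in> null_sets lebesgue"
    using assms negligible_iff_null_sets by blast
  then obtain U where U: "open U" "N \<subseteq> U" "U - N \<in> lmeasurable"
      "emeasure lebesgue (U - N) < ennreal e"
    using sets_lebesgue_outer_open[of N e] \<open>e > 0\<close> by auto
  have "emeasure lebesgue U = emeasure lebesgue (U - N)"
    using emeasure_Diff_null_set[OF N, of U] U(1) by auto
  with U that show thesis by simp
qed

text \<open>The single interval between two nearby points is already an admissible family.\<close>

lemma absolutely_cont_on_imp_continuous_on:
  fixes f :: "real \<Rightarrow> 'a::metric_space"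
  assumes "absolutely_cont_on {a..b} f"
  shows "continuous_on {a..b} f"
  unfolding continuous_on_iff
proof (intro ballI allI impI)
  fix x e :: real assume x: "x \<in> {a..b}" and "e > 0"
  then obtain d where "d > 0" and d: "\<And>(n::nat) u v.
      (\<forall>i<n. u i \<le> v i \<and> {u i..v i} \<subseteq> {a..b}) \<and>
      disjoint_family_on (\<lambda>i. {u i<..<v i}) {..<n} \<and> (\<Sum>i<n. v i - u i) < d \<Longrightarrow>
      (\<Sum>i<n. dist (f (v i)) (f (u i))) < e"
    using assms unfolding absolutely_cont_on_def by meson
  have d1: "dist (f v) (f u) < e" if "u \<in> {a..b}" "v \<in> {a..b}" "u \<le> v" "v - u < d" for u v
    using d[of 1 "\<lambda>_. u" "\<lambda>_. v"] that by (auto simp: disjoint_family_on_def lessThan_Suc)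
  show "\<exists>d>0. \<forall>x'\<in>{a..b}. dist x' x < d \<longrightarrow> dist (f x') (f x) < e"
  proof (intro exI[of _ d] conjI ballI impI)
    fix t assume "t \<in> {a..b}" "dist t x < d"
    then show "dist (f t) (f x) < e"
      using d1[of x t] d1[of t x] x by (cases "x \<le> t") (auto simp: dist_real_def dist_commute)
  qed (fact \<open>d > 0\<close>)
qed

text \<open>Take a tagged division fine for a gauge that is a neighbourhood of small measure around the
  exceptional null set: there absolute continuity bounds the increments, elsewhere the
  hypothesis does.\<close>

lemma absolutely_cont_on_nonincreasing:
  fixes f :: "real \<Rightarrow> real"
  assumes "a \<le> b" and ac: "absolutely_cont_on {a..b} f"
    and ae: "AE x in lebesgue. a < x \<and> x < b \<longrightarrow>
      (\<forall>e>0. \<exists>d>0. \<forall>u v. a \<le> u \<and> u \<le> x \<and> x \<le> v \<and> v \<le> b \<and> v - u < d \<longrightarrow>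
        f v - f u \<le> e * (v - u))"
  shows "f b \<le> f a"
proof (rule field_le_epsilon)
  fix e0 :: real assume "e0 > 0"
  \<comment> \<open>This \<open>e\<close> is spent \<open>b - a\<close> times on the good pieces and
    once on the bad ones; the added 1 also keeps the divisor positive when
    \<open>a = b\<close>.\<close>
  define e where "e = e0 / (b - a + 1)"
  have "e > 0" using \<open>e0 > 0\<close> \<open>a \<le> b\<close> by (simp add: e_def)
  define R where "R x \<longleftrightarrow> (\<forall>e>0. \<exists>d>0. \<forall>u v.
      a \<le> u \<and> u \<le> x \<and> x \<le> v \<and> v \<le> b \<and> v - u < d \<longrightarrow> f v - f u \<le> e * (v - u))" for x
  have "AE x in lebesgue. a < x \<and> x < b \<longrightarrow> R x"
    using ae by (simp only: R_def)
  then obtain N0 where N0: "N0 \<in> null_sets lebesgue" and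
    good0: "\<And>x. x \<in> space lebesgue - N0 \<Longrightarrow> a < x \<and> x < b \<longrightarrow> R x"
    by (rule AE_E3) blast
  \<comment> \<open>The hypothesis speaks of interior points only, so the endpoints are treated as
    exceptional too.\<close>
  define N where "N = N0 \<union> {a, b}"
  have "negligible N"
    unfolding N_def using N0 by (simp add: negligible_iff_null_sets[symmetric] negligible_Un_eq)
  have "\<exists>d>0. \<forall>u v. a \<le> u \<and> u \<le> x \<and> x \<le> v \<and> v \<le> b \<and> v - u < d \<longrightarrow> f v - f u \<le> e * (v - u)"
    if "x \<in> {a..b} - N" for x
  proof -
    have "R x" using good0[of x] that by (auto simp: N_def)
    then show ?thesis using \<open>e > 0\<close> unfolding R_def by blast
  qed
  then obtain r where r: "\<And>x. x \<in> {a..b} - N \<Longrightarrow> r x > 0" and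
    good: "\<And>x u v. x \<in> {a..b} - N \<Longrightarrow> a \<le> u \<Longrightarrow> u \<le> x \<Longrightarrow> x \<le> v \<Longrightarrow> v \<le> b \<Longrightarrow>
      v - u < r x \<Longrightarrow> f v - f u \<le> e * (v - u)"
    by metis
  obtain d where "d > 0" and d: "\<And>(P :: (real \<times> real set) set) a' b'. finite P \<Longrightarrow>
      (\<And>i. i \<in> P \<Longrightarrow> a' i \<le> b' i \<and> {a' i..b' i} \<subseteq> {a..b}) \<Longrightarrow>
      disjoint_family_on (\<lambda>i. {a' i<..<b' i}) P \<Longrightarrow>
      (\<Sum>i\<in>P. b' i - a' i) < d \<Longrightarrow> (\<Sum>i\<in>P. dist (f (b' i)) (f (a' i))) < e"
    using absolutely_cont_on_sum_le[OF ac \<open>e > 0\<close>] by blast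
  obtain U where U: "open U" "N \<subseteq> U" "emeasure lebesgue U < ennreal d"
    using negligible_outer_open[OF \<open>negligible N\<close> \<open>d > 0\<close>] by blast
  \<comment> \<open>A piece tagged in \<open>N\<close> lies in \<open>U\<close>. A piece with any
    other tag \<open>x\<close> lies in a ball of half the radius, so its length stays below
    \<open>r x\<close>. No tag falls under the last case.\<close>
  define \<gamma> where "\<gamma> x = (if x \<in> N then U else if x \<in> {a..b} then ball x (r x / 2) else UNIV)" for x
  have "gauge \<gamma>"
    by (rule gaugeI) (use U r in \<open>auto simp: \<gamma>_def\<close>)
  then obtain p where p: "p tagged_division_of {a..b}" "\<gamma> fine p"
    using fine_division_exists_real by blast
  have "finite p" using p(1) by blast
  define \<Phi> where "\<Phi> = (\<lambda>(x::real, K). f (Sup K) - f (Inf K))"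
  define \<Lambda> where "\<Lambda> = (\<lambda>(x::real, K::real set). Sup K - Inf K)"
  have el: "\<exists>u v. K = {u..v} \<and> u \<le> x \<and> x \<le> v \<and> a \<le> u \<and> v \<le> b \<and> Sup K = v \<and> Inf K = u \<and> K \<subseteq> \<gamma> x"
    if xK: "(x, K) \<in> p" for x K
  proof -
    obtain u v where K: "K = {u..v}"
      using tagged_division_ofD(4)[OF p(1) xK] by auto
    have "x \<in> K" "K \<subseteq> {a..b}" using tagged_division_ofD[OF p(1)] xK by blast+
    moreover have "K \<subseteq> \<gamma> x" using p(2) xK by (auto simp: fine_def)
    ultimately show ?thesis
      using K by (intro exI[of _ u] exI[of _ v]) auto
  qed
  have \<Lambda>_nonneg: "\<Lambda> i \<ge> 0" if "i \<in> p" for i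
    using el[of "fst i" "snd i"] that by (cases i) (auto simp: \<Lambda>_def)
  define P where "P = {i \<in> p. fst i \<in> N}"
  define Q where "Q = {i \<in> p. fst i \<notin> N}"
  have fin: "finite P" "finite Q" using \<open>finite p\<close> by (auto simp: P_def Q_def)
  have Pint: "Inf (snd i) \<le> Sup (snd i) \<and> {Inf (snd i)..Sup (snd i)} \<subseteq> {a..b} \<and>
      {Inf (snd i)..Sup (snd i)} \<subseteq> U \<and> snd i = {Inf (snd i)..Sup (snd i)}" if "i \<in> P" for i
    using el[of "fst i" "snd i"] that by (fastforce simp: P_def \<gamma>_def)
  have disj: "disjoint_family_on (\<lambda>i. {Inf (snd i)<..<Sup (snd i)}) P"
    unfolding disjoint_family_on_def
  proof (intro ballI impI)
    fix i j assume ij: "i \<in> P" "j \<in> P" "i \<noteq> j"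
    then have "interior (snd i) \<inter> interior (snd j) = {}"
      using tagged_division_ofD(5)[OF p(1), of "fst i" "snd i" "fst j" "snd j"]
      by (auto simp: P_def prod_eq_iff)
    moreover have "interior (snd k) = {Inf (snd k)<..<Sup (snd k)}" if "k \<in> P" for k
      using Pint[OF that] interior_atLeastAtMost_real by metis
    ultimately show "{Inf (snd i)<..<Sup (snd i)} \<inter> {Inf (snd j)<..<Sup (snd j)} = {}"
      using ij by simp
  qed
  \<comment> \<open>The interiors of the pieces in \<open>P\<close> are disjoint and contained in
    \<open>U\<close>, so their lengths add up to at most its measure.\<close>
  have "ennreal (\<Sum>i\<in>P. Sup (snd i) - Inf (snd i)) = (\<Sum>i\<in>P. ennreal (Sup (snd i) - Inf (snd i)))"
    using Pint by (intro sum_ennreal[symmetric]) auto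
  also have "\<dots> = (\<Sum>i\<in>P. emeasure lebesgue {Inf (snd i)<..<Sup (snd i)})"
    using Pint by (intro sum.cong) auto
  also have "\<dots> = emeasure lebesgue (\<Union>i\<in>P. {Inf (snd i)<..<Sup (snd i)})"
    using fin disj by (intro sum_emeasure) auto
  also have "\<dots> \<le> emeasure lebesgue U"
  proof (rule emeasure_mono)
    show "(\<Union>i\<in>P. {Inf (snd i)<..<Sup (snd i)}) \<subseteq> U" using Pint by fastforce
  qed (use U(1) in auto)
  also note U(3)
  finally have "(\<Sum>i\<in>P. Sup (snd i) - Inf (snd i)) < d"
    using \<open>d > 0\<close> Pint by (subst (asm) ennreal_less_iff) (auto intro!: sum_nonneg)
  then have "(\<Sum>i\<in>P. dist (f (Sup (snd i))) (f (Inf (snd i)))) < e"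
    using Pint by (intro d fin disj) blast
  moreover have "sum \<Phi> P \<le> (\<Sum>i\<in>P. dist (f (Sup (snd i))) (f (Inf (snd i))))"
    by (intro sum_mono) (auto simp: \<Phi>_def dist_real_def split: prod.split)
  ultimately have P: "sum \<Phi> P \<le> e" by simp
  have "sum \<Phi> Q \<le> (\<Sum>i\<in>Q. e * \<Lambda> i)"
  proof (rule sum_mono)
    fix i assume i: "i \<in> Q"
    obtain x K where xK: "i = (x, K)" by (cases i)
    then have x: "x \<notin> N" and "(x, K) \<in> p" using i by (auto simp: Q_def)
    then obtain u v where uv: "K = {u..v}" "u \<le> x" "x \<le> v" "a \<le> u" "v \<le> b" "Sup K = v" "Inf K = u"
        "K \<subseteq> \<gamma> x"
      using el by metis
    have xab: "x \<in> {a..b} - N" using uv x by auto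
    have "K \<subseteq> ball x (r x / 2)" using uv(8) xab by (simp add: \<gamma>_def)
    then have "u \<in> ball x (r x / 2)" "v \<in> ball x (r x / 2)"
      by (rule subsetD; use uv(1-3) in simp)+
    then have "v - u < r x" using uv(2,3) by (auto simp: dist_real_def)
    then show "\<Phi> i \<le> e * \<Lambda> i"
      using good[OF xab uv(4,2,3,5)] uv(6,7) by (simp add: xK \<Phi>_def \<Lambda>_def)
  qed
  also have "\<dots> = e * sum \<Lambda> Q" by (simp add: sum_distrib_left)
  also have "\<dots> \<le> e * sum \<Lambda> p"
    using \<open>e > 0\<close> \<Lambda>_nonneg \<open>finite p\<close> by (intro mult_left_mono sum_mono2) (auto simp: Q_def)
  also have "sum \<Lambda> p = b - a"
    using additive_tagged_division_1[OF \<open>a \<le> b\<close> p(1), of "\<lambda>x. x"] by (simp add: \<Lambda>_def)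
  finally have Q: "sum \<Phi> Q \<le> e * (b - a)" .
  \<comment> \<open>The increments over a tagged division telescope.\<close>
  have "f b - f a = sum \<Phi> p"
    using additive_tagged_division_1[OF \<open>a \<le> b\<close> p(1), of f] by (simp add: \<Phi>_def)
  also have "\<dots> = sum \<Phi> P + sum \<Phi> Q"
    using sum.union_disjoint[OF fin, of \<Phi>]
    by (simp add: P_def Q_def disjoint_iff flip: Collect_disj_eq) (metis (no_types, lifting) Collect_mem_eq Collect_cong)
  also have "\<dots> \<le> e * (b - a + 1)" using P Q by (simp add: algebra_simps)
  also have "\<dots> = e0" using \<open>a \<le> b\<close> by (simp add: e_def)
  finally show "f b \<le> f a + e0" by simp
qed

section \<open>Distance to a convex set\<close>

text \<open>The foot of \<open>b\<close> is a competitor for the foot of \<open>a\<close>. Applied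
  in both directions, this makes the distance to \<open>G\<close> 1-Lipschitz.\<close>

lemma dist_closest_point_le:
  assumes "closed G" "G \<noteq> {}"
  shows "dist a (closest_point G a) \<le> dist a b + dist b (closest_point G b)"
proof -
  have "dist a (closest_point G a) \<le> dist a (closest_point G b)"
    using assms by (intro closest_point_le closest_point_in_set)
  then show ?thesis using dist_triangle[of a "closest_point G b" b] by linarith
qed

text \<open>The derivative is read off pairs of points straddling \<open>x\<close>, since the foot
  of the perpendicular moves with the point.\<close>

lemma dist_closest_point_straddle:
  fixes w :: "real \<Rightarrow> 'a::euclidean_space"
  assumes G: "convex G" "closed G" "G \<noteq> {}"
    and w: "(w has_vector_derivative D) (at x)"
    and out: "w x \<noteq> closest_point G (w x)"
    and slope: "(w x - closest_point G (w x)) \<bullet> D \<le> r * dist (w x) (closest_point G (w x))"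
    and "e > 0"
  shows "\<exists>d>0. \<forall>u v. u \<le> x \<and> x \<le> v \<and> v - u < d \<longrightarrow>
    dist (w v) (closest_point G (w v)) - dist (w u) (closest_point G (w u)) \<le> (r + e) * (v - u)"
proof -
  let ?p = "\<lambda>t. closest_point G (w t)"
  have wc: "isCont w x"
    using w has_vector_derivative_continuous by blast
  have pc: "isCont ?p x"
    using continuous_at_compose[OF wc continuous_at_closest_point[OF G]] by (simp add: o_def)
  \<comment> \<open>The unit vector from the foot at one time to the point at another, 0 where they
    coincide. As a function of the pair of times it is continuous at \<open>(x, x)\<close>, because
    \<open>w x\<close> differs from its foot.\<close>
  define n where "n z = sgn (w (snd z) - ?p (fst z))" for z :: "real \<times> real"
  have nc: "isCont n (x, x)"
    unfolding n_def using wc pc out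
    by (intro continuous_intros isCont_o2[OF isCont_fst] isCont_o2[OF isCont_snd]) auto
  \<comment> \<open>Chosen so that a change of direction below \<open>e1\<close> alters the product
    with \<open>D\<close> by at most \<open>e / 2\<close>; the added 1 covers
    \<open>D = 0\<close>.\<close>
  define e1 where "e1 = min 1 (e / (2 * (norm D + 1)))"
  define e2 where "e2 = e / 2"
  have e12: "e1 > 0" "e2 > 0" using \<open>e > 0\<close>
    by (auto simp: e1_def e2_def intro!: divide_pos_pos add_nonneg_pos)
  obtain d1 where d1: "d1 > 0" "\<And>z. dist z (x, x) < d1 \<Longrightarrow> dist (n z) (n (x, x)) < e1"
    using nc e12(1) unfolding continuous_at_eps_delta by blast
  obtain d2 where d2: "d2 > 0" "\<And>t. norm (t - x) < d2 \<Longrightarrow>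
      norm (w t - w x - (t - x) *\<^sub>R D) \<le> e2 * norm (t - x)"
    using w e12(2) unfolding has_vector_derivative_def has_derivative_at_alt by blast
  define \<delta> where "\<delta> = min (d1 / 2) d2"
  have norm1: "n (x, x) \<bullet> D \<le> r"
  proof -
    have "n (x, x) \<bullet> D = ((w x - ?p x) \<bullet> D) / dist (w x) (?p x)"
      by (simp add: n_def sgn_div_norm dist_norm divide_inverse_commute)
    then show ?thesis using slope out by (simp add: divide_le_eq)
  qed
  show ?thesis
  proof (intro exI[of _ \<delta>] conjI allI impI)
    show "\<delta> > 0" using d1 d2 by (simp add: \<delta>_def)
    fix u v assume uv: "u \<le> x \<and> x \<le> v \<and> v - u < \<delta>"
    have "dist (u, v) (x, x) \<le> dist u x + dist v x"
      unfolding dist_prod_def by (simp add: sqrt_sum_squares_le_sum)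
    also have "\<dots> < d1" using uv by (auto simp: dist_real_def \<delta>_def)
    finally have n1: "norm (n (u, v) - n (x, x)) < e1" using d1(2) by (simp add: dist_norm)
    have "norm ((w v - w u) - (v - u) *\<^sub>R D)
        = norm ((w v - w x - (v - x) *\<^sub>R D) - (w u - w x - (u - x) *\<^sub>R D))"
      by (simp add: algebra_simps)
    also have "\<dots> \<le> norm (w v - w x - (v - x) *\<^sub>R D) + norm (w u - w x - (u - x) *\<^sub>R D)"
      by (rule norm_triangle_ineq4)
    also have "\<dots> \<le> e2 * norm (v - x) + e2 * norm (u - x)"
      using uv by (intro add_mono d2(2)) (auto simp: \<delta>_def)
    also have "\<dots> = e2 * (v - u)" using uv by (simp add: algebra_simps)
    finally have n2: "norm ((w v - w u) - (v - u) *\<^sub>R D) \<le> e2 * (v - u)" .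
    have nle: "norm (n (u, v)) \<le> 1" by (simp add: n_def norm_sgn)
    \<comment> \<open>The foot belonging to \<open>u\<close> is a competitor at \<open>v\<close> as
      well, which removes the motion of the foot from the difference.\<close>
    have "dist (w v) (?p v) \<le> dist (w v) (?p u)"
      using G by (intro closest_point_le closest_point_in_set)
    then have "dist (w v) (?p v) - dist (w u) (?p u) \<le> norm (w v - ?p u) - norm (w u - ?p u)"
      by (simp add: dist_norm)
    \<comment> \<open>The vector \<open>n (u, v)\<close> attains the first norm, also when
      \<open>w v = ?p u\<close>, as \<open>sgn 0 = 0\<close>. For the second norm Cauchy-Schwarz
      points in the right direction.\<close>
    also have "\<dots> \<le> n (u, v) \<bullet> (w v - ?p u) - n (u, v) \<bullet> (w u - ?p u)"
    proof -
      have "n (u, v) \<bullet> (w v - ?p u) = norm (w v - ?p u)"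
        by (cases "w v = ?p u") (simp_all add: n_def sgn_div_norm dot_square_norm power2_eq_square)
      moreover have "n (u, v) \<bullet> (w u - ?p u) \<le> norm (n (u, v)) * norm (w u - ?p u)"
        by (rule norm_cauchy_schwarz)
      moreover have "\<dots> \<le> 1 * norm (w u - ?p u)" by (rule mult_right_mono[OF nle]) simp
      ultimately show ?thesis by simp
    qed
    \<comment> \<open>The three terms are the first-order remainder, the change of direction and the
      slope at \<open>x\<close>; the first two cost \<open>e / 2\<close> each per unit of
      time.\<close>
    also have "\<dots> = n (u, v) \<bullet> (w v - w u - (v - u) *\<^sub>R D) + (v - u) * ((n (u, v) - n (x, x)) \<bullet> D)
        + (v - u) * (n (x, x) \<bullet> D)"
      by (simp add: inner_diff_right inner_diff_left algebra_simps)
    also have "\<dots> \<le> e2 * (v - u) + (v - u) * e2 + (v - u) * r"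
    proof (intro add_mono mult_left_mono norm1)
      have "n (u, v) \<bullet> (w v - w u - (v - u) *\<^sub>R D) \<le> norm (n (u, v)) * norm (w v - w u - (v - u) *\<^sub>R D)"
        by (rule norm_cauchy_schwarz)
      also have "\<dots> \<le> 1 * (e2 * (v - u))" using nle n2 by (intro mult_mono) auto
      finally show "n (u, v) \<bullet> (w v - w u - (v - u) *\<^sub>R D) \<le> e2 * (v - u)" by simp
      have "(n (u, v) - n (x, x)) \<bullet> D \<le> norm (n (u, v) - n (x, x)) * norm D"
        by (rule norm_cauchy_schwarz)
      also have "\<dots> \<le> e / (2 * (norm D + 1)) * (norm D + 1)"
        using n1 e12 \<open>e > 0\<close> by (intro mult_mono) (auto simp: e1_def)
      also have "\<dots> = e2"
      proof -
        have "norm D + 1 \<noteq> 0" by (smt (verit) norm_ge_zero)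
        then show ?thesis by (simp add: e2_def field_simps)
      qed
      finally show "(n (u, v) - n (x, x)) \<bullet> D \<le> e2" .
    qed (use uv in auto)
    also have "\<dots> = (r + e) * (v - u)" by (simp add: e2_def algebra_simps)
    finally show "dist (w v) (?p v) - dist (w u) (?p u) \<le> (r + e) * (v - u)" .
  qed
qed

section \<open>Vertices of \<open>F\<close>\<close>

text \<open>A convex combination reaches an upper bound of \<open>f\<close> only if all its weight
  sits on points of \<open>Y\<close> that reach it, and there \<open>g\<close> is controlled. This
  transfers an inequality known at certain vertices to a point that need not be a vertex.\<close>

lemma convex_hull_linear_le:
  fixes f g :: "'a::real_vector \<Rightarrow> real"
  assumes p: "p \<in> convex hull Y" and "finite Y" and "linear f" "linear g"
    and le: "\<And>y. y \<in> Y \<Longrightarrow> f y \<le> f p"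
    and g: "\<And>y. y \<in> Y \<Longrightarrow> f y = f p \<Longrightarrow> b \<le> g y"
  shows "b \<le> g p"
proof -
  obtain u where u: "\<And>y. y \<in> Y \<Longrightarrow> 0 \<le> u y" "sum u Y = 1" "(\<Sum>y\<in>Y. u y *\<^sub>R y) = p"
    using p \<open>finite Y\<close> by (auto simp: convex_hull_finite)
  have lin: "h p = (\<Sum>y\<in>Y. u y * h y)" if "linear h" for h :: "'a \<Rightarrow> real"
    using linear_sum[OF that, of "\<lambda>y. u y *\<^sub>R y" Y] linear_scale[OF that] u(3) by simp
  have "(\<Sum>y\<in>Y. u y * (f p - f y)) = 0"
    using lin[OF \<open>linear f\<close>] u(2) by (simp add: right_diff_distrib sum_subtractf flip: sum_distrib_right)
  then have "u y * (f p - f y) = 0" if "y \<in> Y" for y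
    using that \<open>finite Y\<close> u(1) le by (subst (asm) sum_nonneg_eq_0_iff) auto
  then have "u y * b \<le> u y * g y" if "y \<in> Y" for y
    using that g[OF that] u(1)[OF that] by (cases "u y = 0") (force intro: mult_left_mono)+
  then have "(\<Sum>y\<in>Y. u y * b) \<le> (\<Sum>y\<in>Y. u y * g y)" by (rule sum_mono)
  then show ?thesis using lin[OF \<open>linear g\<close>] u(2) by (simp flip: sum_distrib_right)
qed

lemma hyperplane_L_eq: "hyperplane_L V A cm cp \<alpha> j = V \<inter> {y. A $ j \<bullet> y = bound cm cp \<alpha> j}"
  by (auto simp: hyperplane_L_def inner_axis' matrix_vector_mul_component)

lemma halfspace_L_eq:
  "halfspace_L V A cm cp \<alpha> j = V \<inter> {y. (of_int \<alpha> *\<^sub>R A $ j) \<bullet> y \<le> of_int \<alpha> * bound cm cp \<alpha> j}"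
  by (auto simp: halfspace_L_def inner_axis' matrix_vector_mul_component)

lemma closed_set_F:
  assumes "subspace V"
  shows "closed (set_F V A cm cp M I)"
  unfolding set_F_def hyperplane_L_eq halfspace_L_eq case_prod_beta
  by (intro closed_Int closed_INT ballI closed_hyperplane closed_halfspace_le
      closed_subspace[OF assms])

lemma convex_set_F:
  assumes "subspace V"
  shows "convex (set_F V A cm cp M I)"
  unfolding set_F_def hyperplane_L_eq halfspace_L_eq case_prod_beta
  by (intro convex_Int convex_INT convex_hyperplane convex_halfspace_le
      subspace_imp_convex[OF assms])

lemma inner_row_diagonal:
  fixes A :: "real^'m^'m"
  assumes "\<And>i j. i \<noteq> j \<Longrightarrow> A $ i $ j = 0"
  shows "A $ j \<bullet> v = A $ j $ j * v $ j"
proof -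
  have "A $ j \<bullet> v = (\<Sum>k\<in>UNIV. if k = j then A $ j $ j * v $ j else 0)"
    unfolding inner_vec_def by (intro sum.cong) (auto simp: assms)
  then show ?thesis by simp
qed

text \<open>As \<open>A\<close> is diagonal, the two constraints with index \<open>j\<close> confine
  the single coordinate \<open>v $ j\<close>.\<close>

lemma bounded_set_C:
  assumes A_diag: "\<And>i j. i \<noteq> j \<Longrightarrow> A $ i $ j = 0" and A_pos: "\<And>i. A $ i $ i > 0"
  shows "bounded (set_C V A cm cp)"
proof (rule boundedI)
  fix v assume v: "v \<in> set_C V A cm cp"
  have "\<bar>v $ j\<bar> \<le> (\<bar>cm j\<bar> + \<bar>cp j\<bar>) / A $ j $ j" for j
  proof -
    have "A $ j \<bullet> v = A $ j $ j * v $ j"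
      using A_diag by (rule inner_row_diagonal)
    moreover have "cm j \<le> A $ j \<bullet> v" "A $ j \<bullet> v \<le> cp j"
      using v by (auto simp: set_C_def halfspace_L_eq bound_def)
    ultimately have "\<bar>A $ j $ j * v $ j\<bar> \<le> \<bar>cm j\<bar> + \<bar>cp j\<bar>" by linarith
    then show ?thesis using A_pos[of j] by (simp add: abs_mult field_simps)
  qed
  then show "norm v \<le> (\<Sum>j\<in>UNIV. (\<bar>cm j\<bar> + \<bar>cp j\<bar>) / A $ j $ j)"
    by (intro order_trans[OF norm_le_l1_cart] sum_mono)
qed

text \<open>The constraints active at an extreme point \<open>x\<close> of \<open>F\<close> are all active at some
  \<open>ystar i\<close>, so small steps from \<open>x\<close> along \<open>ystar i - x\<close> in both directions stay in \<open>F\<close>.\<close>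

lemma extreme_point_set_F:
  fixes V :: "(real^'m) set"
  assumes V: "subspace V" and "M \<ge> 1"
    and I: "\<And>i. i \<in> {0..M} \<Longrightarrow> I i \<subseteq> {-1, 1} \<times> UNIV"
    and vertex: "\<And>i. i \<in> {1..M} \<Longrightarrow> ystar i \<in> hyperplanes_meet V A cm cp (I 0 \<union> I i)"
    and J_ex: "\<And>x. x \<in> set_F V A cm cp M I \<Longrightarrow> \<exists>J. represents_active V A cm cp M I J x"
    and x: "x extreme_point_of set_F V A cm cp M I"
  shows "x \<in> ystar ` {1..M}"
proof -
  have xF: "x \<in> set_F V A cm cp M I" using x by (simp add: extreme_point_of_def)
  then have xV: "x \<in> V" by (simp add: set_F_def)
  obtain J where J: "represents_active V A cm cp M I J x" using J_ex xF by blast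
  \<comment> \<open>If \<open>J = {}\<close>, only the constraints in \<open>I 0\<close> are active
    and any vertex serves; otherwise any member of \<open>J\<close> does.\<close>
  obtain i where i: "i \<in> {1..M}" and act: "active_set V A cm cp x \<subseteq> I 0 \<union> I i"
  proof (cases "J = {}")
    case True
    then show thesis using that[of 1] J \<open>M \<ge> 1\<close> by (auto simp: represents_active_def)
  next
    case False
    then obtain i where "i \<in> J" by blast
    have "i \<in> {1..M}" using J \<open>i \<in> J\<close> by (auto simp: represents_active_def)
    moreover have "active_set V A cm cp x = I 0 \<union> (\<Inter>k\<in>J. I k)"
      using J False by (simp add: represents_active_def)
    ultimately show thesis using that[of i] \<open>i \<in> J\<close> by blast
  qed
  define v where "v = ystar i - x"
  have yV: "ystar i \<in> V" using vertex[OF i] by (simp add: hyperplanes_meet_def)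
  have vV: "v \<in> V" unfolding v_def using V yV xV by (rule subspace_diff)
  have orth: "A $ j \<bullet> v = 0" if "(\<alpha>, j) \<in> active_set V A cm cp x" for \<alpha> j
  proof -
    have "ystar i \<in> hyperplane_L V A cm cp \<alpha> j"
      using vertex[OF i] act that by (fastforce simp: hyperplanes_meet_def)
    moreover have "x \<in> hyperplane_L V A cm cp \<alpha> j"
      using that by (simp add: active_set_def)
    ultimately show ?thesis by (simp add: hyperplane_L_eq v_def inner_diff_right)
  qed
  \<comment> \<open>The constraints inactive at \<open>x\<close> hold there strictly. Being finitely
    many, they survive a common small step.\<close>
  define Q where "Q = (\<Union>k\<in>{1..M}. I k) - active_set V A cm cp x"
  have Ik: "(\<alpha>, j) \<in> I k \<Longrightarrow> k \<in> {0..M} \<Longrightarrow> \<alpha> \<in> {-1, 1}" for \<alpha> j k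
    using I[of k] by blast
  have "finite Q"
  proof (rule finite_subset)
    show "Q \<subseteq> {-1, 1} \<times> UNIV" using I unfolding Q_def by fastforce
  qed auto
  have "\<forall>q\<in>Q. \<forall>\<^sub>F s in nhds 0. of_int (fst q) * (A $ snd q \<bullet> (x + s *\<^sub>R v))
      < of_int (fst q) * bound cm cp (fst q) (snd q)"
  proof
    fix q assume "q \<in> Q"
    then obtain \<alpha> j k where q: "q = (\<alpha>, j)" "(\<alpha>, j) \<in> I k" "k \<in> {1..M}"
        "(\<alpha>, j) \<notin> active_set V A cm cp x"
      by (cases q) (auto simp: Q_def)
    have \<alpha>: "\<alpha> \<in> {-1, 1}" using Ik[of \<alpha> j k] q by auto
    have "x \<in> halfspace_L V A cm cp \<alpha> j" using xF q unfolding set_F_def by blast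
    moreover have "x \<notin> hyperplane_L V A cm cp \<alpha> j" using \<alpha> q(4) by (auto simp: active_set_def)
    ultimately have "of_int \<alpha> * (A $ j \<bullet> (x + 0 *\<^sub>R v)) < of_int \<alpha> * bound cm cp \<alpha> j"
      using \<alpha> by (auto simp: halfspace_L_eq hyperplane_L_eq)
    moreover have "((\<lambda>s. of_int \<alpha> * (A $ j \<bullet> (x + s *\<^sub>R v))) \<longlongrightarrow>
        of_int \<alpha> * (A $ j \<bullet> (x + 0 *\<^sub>R v))) (nhds 0)"
      by (intro tendsto_intros) (simp add: filterlim_ident)
    ultimately have "\<forall>\<^sub>F s in nhds 0.
        of_int \<alpha> * (A $ j \<bullet> (x + s *\<^sub>R v)) < of_int \<alpha> * bound cm cp \<alpha> j"
      by (intro order_tendstoD(2))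
    then show "\<forall>\<^sub>F s in nhds 0. of_int (fst q) * (A $ snd q \<bullet> (x + s *\<^sub>R v))
      < of_int (fst q) * bound cm cp (fst q) (snd q)"
      by (simp add: q)
  qed
  with \<open>finite Q\<close> have "\<forall>\<^sub>F s in nhds 0. \<forall>q\<in>Q. of_int (fst q) * (A $ snd q \<bullet> (x + s *\<^sub>R v))
      < of_int (fst q) * bound cm cp (fst q) (snd q)"
    by (rule eventually_ball_finite)
  then obtain d :: real where "d > 0" and d: "\<And>s q. \<bar>s\<bar> < d \<Longrightarrow> q \<in> Q \<Longrightarrow>
      of_int (fst q) * (A $ snd q \<bullet> (x + s *\<^sub>R v)) < of_int (fst q) * bound cm cp (fst q) (snd q)"
    by (auto simp: eventually_nhds_metric)
  have inF: "x + s *\<^sub>R v \<in> set_F V A cm cp M I" if s: "\<bar>s\<bar> < d" for s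
  proof -
    have sV: "x + s *\<^sub>R v \<in> V" using V xV vV by (intro subspace_add subspace_scale)
    have hyp: "x + s *\<^sub>R v \<in> hyperplane_L V A cm cp \<alpha> j"
      if "(\<alpha>, j) \<in> active_set V A cm cp x" for \<alpha> j
      using orth[OF that] that sV by (auto simp: active_set_def hyperplane_L_eq inner_add_right)
    have "x + s *\<^sub>R v \<in> halfspace_L V A cm cp \<alpha> j" if "(\<alpha>, j) \<in> I k" "k \<in> {1..M}" for \<alpha> j k
    proof (cases "(\<alpha>, j) \<in> active_set V A cm cp x")
      case True
      then show ?thesis using hyp[OF True] by (auto simp: hyperplane_L_eq halfspace_L_eq)
    next
      case False
      then have "(\<alpha>, j) \<in> Q" using that by (auto simp: Q_def)
      then show ?thesis using d[OF s] sV by (force simp: halfspace_L_eq)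
    qed
    moreover have "(\<alpha>, j) \<in> active_set V A cm cp x" if "(\<alpha>, j) \<in> I 0" for \<alpha> j
      using that J by (auto simp: represents_active_def)
    ultimately show ?thesis using sV hyp by (auto simp: set_F_def)
  qed
  \<comment> \<open>Otherwise \<open>x\<close> would be the midpoint of a nondegenerate segment
    inside the polytope.\<close>
  have "v = 0"
  proof (rule ccontr)
    assume "v \<noteq> 0"
    define u where "u = (d / 2) *\<^sub>R v"
    have "x = midpoint (x - u) (x + u)"
      by (simp add: midpoint_def flip: scaleR_2)
    moreover have "x - u \<noteq> x + u" using \<open>v \<noteq> 0\<close> \<open>d > 0\<close>
      by (simp add: u_def algebra_simps flip: scaleR_2)
    ultimately have "x \<in> open_segment (x - u) (x + u)"
      using midpoint_in_open_segment by metis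
    moreover have "x - u \<in> set_F V A cm cp M I" "x + u \<in> set_F V A cm cp M I"
      using inF[of "d / 2"] inF[of "- (d / 2)"] \<open>d > 0\<close> by (simp_all add: u_def)
    ultimately show False using x by (auto simp: extreme_point_of_def)
  qed
  then show ?thesis using i by (auto simp: v_def)
qed

text \<open>By Minkowski's theorem a compact convex set is the hull of its extreme points, and these
  are among the \<open>ystar i\<close>. Compactness comes from the inclusion in the bounded set
  \<open>set_C V A cm cp\<close>.\<close>

lemma set_F_subset_convex_hull:
  fixes V :: "(real^'m) set"
  assumes V: "subspace V" and A_diag: "\<And>i j. i \<noteq> j \<Longrightarrow> A $ i $ j = 0"
    and A_pos: "\<And>i. A $ i $ i > 0" and "M \<ge> 1"
    and I: "\<And>i. i \<in> {0..M} \<Longrightarrow> I i \<subseteq> {-1, 1} \<times> UNIV"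
    and vertex: "\<And>i. i \<in> {1..M} \<Longrightarrow> ystar i \<in> hyperplanes_meet V A cm cp (I 0 \<union> I i)"
    and J_ex: "\<And>x. x \<in> set_F V A cm cp M I \<Longrightarrow> \<exists>J. represents_active V A cm cp M I J x"
    and F_C: "set_F V A cm cp M I \<subseteq> set_C V A cm cp"
  shows "set_F V A cm cp M I \<subseteq> convex hull (ystar ` {1..M})"
proof -
  have "compact (set_F V A cm cp M I)"
    unfolding compact_eq_bounded_closed
    using closed_set_F[OF V] bounded_set_C[OF A_diag A_pos] F_C bounded_subset by blast
  then have "set_F V A cm cp M I = convex hull {x. x extreme_point_of set_F V A cm cp M I}"
    using convex_set_F[OF V] by (rule Krein_Milman_Minkowski)
  also have "\<dots> \<subseteq> convex hull (ystar ` {1..M})"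
    using extreme_point_set_F[OF V \<open>M \<ge> 1\<close> I vertex J_ex] by (intro hull_mono) blast
  finally show ?thesis .
qed

text \<open>An isometry from the \<open>A\<close>-norm to the Euclidean norm, giving access to \<open>closest_point\<close>.\<close>

definition sqrt_scale :: "real^'m^'m \<Rightarrow> real^'m \<Rightarrow> real^'m" where
  "sqrt_scale A x = (\<chi> i. sqrt (A $ i $ i) * x $ i)"

lemma linear_sqrt_scale: "linear (sqrt_scale A)"
  by (rule linearI) (simp_all add: sqrt_scale_def vec_eq_iff algebra_simps)

lemma inner_diagonal_sqrt_scale:
  assumes A_diag: "\<And>i j. i \<noteq> j \<Longrightarrow> A $ i $ j = 0" and A_pos: "\<And>i. A $ i $ i > 0"
  shows "x \<bullet> (A *v y) = sqrt_scale A x \<bullet> sqrt_scale A y"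
proof -
  have "(A *v y) $ i = A $ i $ i * y $ i" for i
    using inner_row_diagonal[OF A_diag] by (simp add: matrix_vector_mul_component)
  moreover have "x $ i * (A $ i $ i * y $ i) = sqrt (A $ i $ i) * x $ i * (sqrt (A $ i $ i) * y $ i)" for i
    using A_pos[of i] real_sqrt_mult_self[of "A $ i $ i"] by (simp add: algebra_simps)
  ultimately show ?thesis unfolding inner_vec_def sqrt_scale_def
    by (simp only: inner_real_def vec_lambda_beta)
qed

lemma normA_eq_norm_sqrt_scale:
  assumes "\<And>i j. i \<noteq> j \<Longrightarrow> A $ i $ j = 0" and "\<And>i. A $ i $ i > 0"
  shows "normA A x = norm (sqrt_scale A x)"
  by (simp add: normA_def inner_diagonal_sqrt_scale[OF assms] norm_eq_sqrt_inner)

lemma inj_sqrt_scale: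
  assumes "\<And>i. A $ i $ i > 0"
  shows "inj (sqrt_scale A)"
proof (rule injI)
  fix x y assume "sqrt_scale A x = sqrt_scale A y"
  then have "sqrt (A $ i $ i) * x $ i = sqrt (A $ i $ i) * y $ i" for i
    by (simp add: sqrt_scale_def vec_eq_iff)
  then show "x = y" using assms by (simp add: vec_eq_iff less_imp_neq[symmetric])
qed

text \<open>Ensures that the supremum in \<open>tau_d\<close> dominates each of its terms; over the
  reals \<open>SUP\<close> carries no such information for an unbounded family.\<close>

lemma normA_bdd_above:
  assumes A_diag: "\<And>i j. i \<noteq> j \<Longrightarrow> A $ i $ j = 0" and A_pos: "\<And>i. A $ i $ i > 0"
    and "bounded C" "finite S"
  shows "bdd_above ((\<lambda>(v, i). normA A (v - ystar i)) ` (C \<times> S))"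
proof -
  obtain B where B: "\<And>x. norm (sqrt_scale A x) \<le> B * norm x" "B > 0"
    using linear_bounded_pos[OF linear_sqrt_scale] by blast
  obtain R where R: "\<And>v. v \<in> C \<Longrightarrow> norm v \<le> R"
    using \<open>bounded C\<close> by (auto simp: bounded_iff)
  show ?thesis
  proof (rule bdd_aboveI2, clarsimp)
    fix v i assume "v \<in> C" "i \<in> S"
    have "normA A (v - ystar i) \<le> B * norm (v - ystar i)"
      using B by (simp add: normA_eq_norm_sqrt_scale[OF A_diag A_pos])
    also have "norm (v - ystar i) \<le> norm v + norm (ystar i)" by (rule norm_triangle_ineq4)
    also have "\<dots> \<le> R + (\<Sum>i\<in>S. norm (ystar i))"
      using R[OF \<open>v \<in> C\<close>] \<open>i \<in> S\<close> \<open>finite S\<close> by (intro add_mono member_le_sum) auto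
    finally show "normA A (v - ystar i) \<le> B * (R + (\<Sum>i\<in>S. norm (ystar i)))"
      using B(2) by simp
  qed
qed

theorem corollary2:
  fixes V :: "(real^'m) set" and A :: "real^'m^'m" and d M :: nat
    and c y :: "real \<Rightarrow> real^'m" and cm cp :: "'m \<Rightarrow> real"
    and I :: "nat \<Rightarrow> (int \<times> 'm) set" and ystar :: "nat \<Rightarrow> real^'m" and \<epsilon> :: real
  assumes "subspace V" and "dim V = d"
    and A_diag: "\<And>i j. i \<noteq> j \<Longrightarrow> A $ i $ j = 0"
    and A_pos: "\<And>i. A $ i $ i > 0"
    and c_V: "\<And>t. t \<ge> 0 \<Longrightarrow> c t \<in> V"
    and c_lip: "\<exists>K. K-lipschitz_on {0..} c"
    and M: "M \<ge> 1"
    and I: "\<And>i. i \<in> {0..M} \<Longrightarrow> I i \<subseteq> {-1, 1} \<times> UNIV"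
    and vertex: "\<And>i. i \<in> {1..M} \<Longrightarrow> hyperplanes_meet V A cm cp (I 0 \<union> I i) = {ystar i}"
    and vertex_F: "\<And>i. i \<in> {1..M} \<Longrightarrow> ystar i \<in> set_F V A cm cp M I"
    and J_ex: "\<And>x. x \<in> set_F V A cm cp M I \<Longrightarrow> \<exists>J. represents_active V A cm cp M I J x"
    and J_vertex: "\<And>i. i \<in> {1..M} \<Longrightarrow> represents_active V A cm cp M I {i} (ystar i)"
    and F_C: "set_F V A cm cp M I \<subseteq> set_C V A cm cp"
    and eps: "\<epsilon> > 0"
    and incl: "AE t in lebesgue. t \<in> {0..tau_d A (set_C V A cm cp) M ystar \<epsilon>} \<longrightarrow>
      (\<exists>D. (c has_vector_derivative D) (at t) \<and>
        (\<forall>i\<in>{1..M}.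
          (\<lambda>x. - D + x) ` (cballA V A \<epsilon> \<inter> normal_coneA V A (set_F V A cm cp M I) (ystar i))
            \<subseteq> normal_coneA V A (set_C V A cm cp) (ystar i)))"
    and sol: "sweeping_solution V A (translate_by (set_C V A cm cp) c) y"
    and init: "y 0 \<in> translate_by (set_C V A cm cp) c 0"
  shows "y (tau_d A (set_C V A cm cp) M ystar \<epsilon>)
    \<in> translate_by (set_F V A cm cp M I) c (tau_d A (set_C V A cm cp) M ystar \<epsilon>)"
proof -

  \<comment> \<open>Notation and reduction to fixed sets\<close>
  define C where "C = set_C V A cm cp"
  define F where "F = set_F V A cm cp M I"
  define S where "S = sqrt_scale A"
  define \<tau> where "\<tau> = tau_d A C M ystar \<epsilon>"
  note V = \<open>subspace V\<close>
  have S: "linear S" "inj S" using linear_sqrt_scale inj_sqrt_scale A_pos by (auto simp: S_def)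
  have inner_S: "u \<bullet> (A *v v) = S u \<bullet> S v" for u v
    unfolding S_def using A_diag A_pos by (rule inner_diagonal_sqrt_scale)
  have norm_S: "normA A u = norm (S u)" for u
    unfolding S_def using A_diag A_pos by (rule normA_eq_norm_sqrt_scale)
  note S_diff = linear_diff[OF S(1)] and S_add = linear_add[OF S(1)] and S_scale = linear_scale[OF S(1)]
  have CV: "C \<subseteq> V" by (auto simp: C_def set_C_def halfspace_L_def)
  have FC: "F \<subseteq> C" using F_C by (simp add: F_def C_def)
  have Y: "ystar i \<in> F" if "i \<in> {1..M}" for i using vertex_F that by (simp add: F_def)
  have hull: "F \<subseteq> convex hull (ystar ` {1..M})"
    unfolding F_def using V A_diag A_pos M I _ J_ex F_C
    by (rule set_F_subset_convex_hull) (use vertex in auto)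
  have "bounded C" unfolding C_def using A_diag A_pos by (rule bounded_set_C)
  define G where "G = S ` F"
  have "compact F" "convex F"
    using closed_set_F[OF V] convex_set_F[OF V] \<open>bounded C\<close> FC bounded_subset
    by (auto simp: F_def compact_eq_bounded_closed)
  then have G: "convex G" "closed G" "G \<noteq> {}"
    using S(1) Y[of 1] M
    by (auto simp: G_def convex_linear_image linear_linear
        intro!: compact_imp_closed compact_continuous_image linear_continuous_on
        simp flip: linear_conv_bounded_linear)
  \<comment> \<open>Passing to \<open>z\<close> removes the translation, so the moving sets become
    the fixed \<open>C\<close> and \<open>F\<close>. After the isometry \<open>S\<close>,
    \<open>h t\<close> is the distance from \<open>z t\<close> to \<open>F\<close> in the norm
    \<open>normA A\<close>.\<close>
  define z where "z t = y t - c t" for t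
  define w where "w t = S (z t)" for t
  define h where "h t = dist (w t) (closest_point G (w t))" for t
  have h_nonneg: "h t \<ge> 0" for t by (simp add: h_def)
  have zC: "z t \<in> C" if "t \<ge> 0" for t
    using sol that by (auto simp: sweeping_solution_def translate_by_def z_def C_def)
  have y_ac: "absolutely_cont_on {a..b} y" if "0 \<le> a" for a b
    using sol that by (auto simp: sweeping_solution_def locally_absolutely_cont_on_def)
  obtain K where K: "K-lipschitz_on {0..} c" using c_lip by blast
  obtain B where B: "\<And>u. norm (S u) \<le> B * norm u" "B > 0"
    using linear_bounded_pos[OF S(1)] by blast
  \<comment> \<open>A bound of the shape that carries absolute continuity from \<open>y\<close> to
    \<open>h\<close>, with the Lipschitz function \<open>c\<close> contributing only the length
    term.\<close>
  have h_inc: "\<bar>h v - h u\<bar> \<le> B * dist (y v) (y u) + B * K * (v - u)" if "0 \<le> u" "u \<le> v" for u v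
  proof -
    have "\<bar>h v - h u\<bar> \<le> dist (w v) (w u)"
      using dist_closest_point_le[OF G(2,3), of "w v" "w u"]
        dist_closest_point_le[OF G(2,3), of "w u" "w v"]
      by (simp add: h_def dist_commute)
    also have "\<dots> \<le> B * norm (z v - z u)"
      using B(1)[of "z v - z u"] by (simp add: w_def dist_norm S_diff)
    also have "norm (z v - z u) \<le> norm (y v - y u) + norm (c v - c u)"
      using norm_triangle_ineq4[of "y v - y u" "c v - c u"] by (simp add: z_def algebra_simps)
    also have "norm (c v - c u) \<le> K * (v - u)"
      using lipschitz_onD[OF K, of v u] that by (simp add: dist_norm)
    finally show ?thesis using B(2) by (simp add: dist_norm algebra_simps)
  qed

  \<comment> \<open>Differential inequality for the distance to \<open>F\<close>\<close>
  have good: "AE t in lebesgue. 0 \<le> t \<and> t \<le> \<tau> \<and> h t \<noteq> 0 \<longrightarrow>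
      (\<exists>D. (w has_vector_derivative D) (at t) \<and>
        (w t - closest_point G (w t)) \<bullet> D \<le> - \<epsilon> * dist (w t) (closest_point G (w t)))"
  proof -
    have sol': "AE t in lebesgue. 0 \<le> t \<longrightarrow> (\<exists>D. (y has_vector_derivative D) (at t) \<and>
        - D \<in> normal_coneA V A (translate_by C c t) (y t))"
      using sol by (simp add: sweeping_solution_def C_def)
    from incl sol' show ?thesis
    proof eventually_elim
      fix t
      assume "t \<in> {0..tau_d A (set_C V A cm cp) M ystar \<epsilon>} \<longrightarrow>
        (\<exists>D. (c has_vector_derivative D) (at t) \<and>
          (\<forall>i\<in>{1..M}.
            (\<lambda>x. - D + x) ` (cballA V A \<epsilon> \<inter> normal_coneA V A (set_F V A cm cp M I) (ystar i))
              \<subseteq> normal_coneA V A (set_C V A cm cp) (ystar i)))"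
        and yt: "0 \<le> t \<longrightarrow> (\<exists>D. (y has_vector_derivative D) (at t) \<and>
          - D \<in> normal_coneA V A (translate_by C c t) (y t))"
      then have ct: "t \<in> {0..\<tau>} \<longrightarrow> (\<exists>D. (c has_vector_derivative D) (at t) \<and>
          (\<forall>i\<in>{1..M}. (\<lambda>x. - D + x) ` (cballA V A \<epsilon> \<inter> normal_coneA V A F (ystar i))
              \<subseteq> normal_coneA V A C (ystar i)))"
        by (simp add: \<tau>_def C_def F_def)
      show "0 \<le> t \<and> t \<le> \<tau> \<and> h t \<noteq> 0 \<longrightarrow>
        (\<exists>D. (w has_vector_derivative D) (at t) \<and>
          (w t - closest_point G (w t)) \<bullet> D \<le> - \<epsilon> * dist (w t) (closest_point G (w t)))"
      proof
        assume t: "0 \<le> t \<and> t \<le> \<tau> \<and> h t \<noteq> 0"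
        obtain Dc where Dc: "(c has_vector_derivative Dc) (at t)"
          and Dc_cone: "\<forall>i\<in>{1..M}. (\<lambda>x. - Dc + x) ` (cballA V A \<epsilon> \<inter> normal_coneA V A F (ystar i))
              \<subseteq> normal_coneA V A C (ystar i)"
          using ct t by (meson atLeastAtMost_iff)
        have cone: "- Dc + x \<in> normal_coneA V A C (ystar i)"
          if "i \<in> {1..M}" "x \<in> cballA V A \<epsilon>" "x \<in> normal_coneA V A F (ystar i)" for i x
          using Dc_cone that by blast
        obtain Dy where Dy: "(y has_vector_derivative Dy) (at t)"
          and cone_y: "- Dy \<in> normal_coneA V A (translate_by C c t) (y t)"
          using yt t by auto
        have "closest_point G (w t) \<in> S ` F"
          using closest_point_in_set[OF G(2,3)] by (simp add: G_def)
        then obtain p where p: "p \<in> F" and Sp: "closest_point G (w t) = S p" by auto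
        have ht: "h t = norm (S (z t - p))"
          unfolding h_def Sp by (simp add: w_def dist_norm S_diff)
        have "h t > 0" using t h_nonneg[of t] by auto
        \<comment> \<open>The perturbation of the largest admissible size \<open>\<epsilon>\<close>,
          pointing from the projection \<open>p\<close> to \<open>z t\<close>.\<close>
        define n where "n = (\<epsilon> / h t) *\<^sub>R (z t - p)"
        have "z t \<in> C" using zC t by simp
        have "n \<in> V"
          unfolding n_def using V p FC CV \<open>z t \<in> C\<close> by (intro subspace_scale subspace_diff) auto
        moreover have "normA A n = \<epsilon>"
          using \<open>h t > 0\<close> eps by (simp add: norm_S n_def S_scale flip: ht)
        ultimately have n_ball: "n \<in> cballA V A \<epsilon>" by (simp add: cballA_def)
        have n_max: "n \<bullet> (A *v \<xi>) \<le> n \<bullet> (A *v p)" if "\<xi> \<in> F" for \<xi>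
        proof -
          have "(w t - S p) \<bullet> (S \<xi> - S p) \<le> 0"
            using closest_point_dot[OF G(1,2), of "S \<xi>" "w t"] that
            unfolding Sp by (simp add: G_def)
          then have "\<epsilon> / h t * ((w t - S p) \<bullet> (S \<xi> - S p)) \<le> 0"
            using eps \<open>h t > 0\<close> by (intro mult_nonneg_nonpos) auto
          then show ?thesis
            by (simp add: inner_S n_def w_def S_diff S_scale inner_diff_right right_diff_distrib
                diff_divide_distrib)
        qed
        \<comment> \<open>At a vertex where the pairing with \<open>n\<close> equals its maximum
          over \<open>F\<close>, \<open>n\<close> is normal to \<open>F\<close>, so the assumed
          inclusion applies. The convex combination then carries the inequality to
          \<open>p\<close>.\<close>
        have "(n - Dc) \<bullet> (A *v z t) \<le> (n - Dc) \<bullet> (A *v p)"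
        proof (rule convex_hull_linear_le[of p "ystar ` {1..M}" "\<lambda>x. n \<bullet> (A *v x)"
              "\<lambda>x. (n - Dc) \<bullet> (A *v x)"])
          show "p \<in> convex hull (ystar ` {1..M})" using hull p by blast
          show "linear (\<lambda>x. n \<bullet> (A *v x))" "linear (\<lambda>x. (n - Dc) \<bullet> (A *v x))"
            by (auto intro!: linearI simp: matrix_vector_right_distrib matrix_vector_mult_scaleR inner_add_right)
          fix q assume "q \<in> ystar ` {1..M}"
          then obtain i where i: "i \<in> {1..M}" "q = ystar i" by blast
          then show "n \<bullet> (A *v q) \<le> n \<bullet> (A *v p)" using n_max Y by simp
          assume "n \<bullet> (A *v q) = n \<bullet> (A *v p)"
          then have "n \<in> normal_coneA V A F (ystar i)"
            using n_max i Y \<open>n \<in> V\<close>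
            by (simp add: normal_coneA_def matrix_vector_mult_diff_distrib inner_diff_right)
          then have "- Dc + n \<in> normal_coneA V A C (ystar i)"
            using cone i n_ball by blast
          then show "(n - Dc) \<bullet> (A *v z t) \<le> (n - Dc) \<bullet> (A *v q)"
            using \<open>z t \<in> C\<close> i
            by (auto simp: normal_coneA_def matrix_vector_mult_diff_distrib inner_diff_right
                split: if_splits)
        qed simp
        then have "(n - Dc) \<bullet> (A *v (z t - p)) \<le> 0"
          by (simp add: matrix_vector_mult_diff_distrib inner_diff_right)
        moreover have "n \<bullet> (A *v (z t - p)) = \<epsilon> * h t"
          using \<open>h t > 0\<close> by (simp add: inner_S n_def S_scale dot_square_norm power2_eq_square flip: ht)
        ultimately have 1: "\<epsilon> * h t \<le> Dc \<bullet> (A *v (z t - p))"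
          by (simp add: inner_diff_left)
        \<comment> \<open>The inclusion satisfied by \<open>y\<close> is tested with the point of
          the moving set that corresponds to \<open>p\<close>.\<close>
        have "p + c t \<in> translate_by C c t" using p FC by (auto simp: translate_by_def)
        then have "(- Dy) \<bullet> (A *v (p + c t - y t)) \<le> 0"
          using cone_y by (auto simp: normal_coneA_def split: if_splits)
        moreover have "p + c t - y t = - (z t - p)" by (simp add: z_def)
        ultimately have 2: "Dy \<bullet> (A *v (z t - p)) \<le> 0"
          by (simp only: inner_S linear_neg[OF S(1)]) simp
        have "(w has_vector_derivative S (Dy - Dc)) (at t)"
          using bounded_linear.has_vector_derivative[OF _ has_vector_derivative_diff[OF Dy Dc], of S]
            S(1) by (simp add: linear_conv_bounded_linear w_def[abs_def] z_def)
        moreover have "(w t - S p) \<bullet> S (Dy - Dc) = Dy \<bullet> (A *v (z t - p)) - Dc \<bullet> (A *v (z t - p))"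
          by (simp add: inner_S w_def S_diff inner_diff_left inner_diff_right inner_commute)
        then have "(w t - S p) \<bullet> S (Dy - Dc) \<le> - \<epsilon> * h t" using 1 2 by simp
        ultimately show "\<exists>D. (w has_vector_derivative D) (at t) \<and>
          (w t - closest_point G (w t)) \<bullet> D \<le> - \<epsilon> * dist (w t) (closest_point G (w t))"
          unfolding h_def Sp by blast
      qed
    qed
  qed

  \<comment> \<open>Decay of the distance at rate \<open>\<epsilon>\<close>\<close>
  have decay: "h b + \<epsilon> * b \<le> h a + \<epsilon> * a"
    if ab: "0 \<le> a" "a \<le> b" "b \<le> \<tau>" and pos: "\<And>t. a < t \<Longrightarrow> t < b \<Longrightarrow> h t \<noteq> 0" for a b
  \<comment> \<open>Adding \<open>\<epsilon> * t\<close> turns the decay rate into monotonicity.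
    Zeros of \<open>h\<close> are excluded in the interior only, so that the interval may start at a
    zero.\<close>
  proof (rule absolutely_cont_on_nonincreasing[OF ab(2)])
    show "absolutely_cont_on {a..b} (\<lambda>t. h t + \<epsilon> * t)"
    proof (rule absolutely_cont_on_le[OF y_ac[OF ab(1)]])
      fix u v assume "u \<in> {a..b}" "v \<in> {a..b}" "u \<le> v"
      then have "\<bar>h v - h u\<bar> \<le> B * dist (y v) (y u) + B * K * (v - u)"
        using ab by (intro h_inc) auto
      moreover have "\<bar>\<epsilon> * v - \<epsilon> * u\<bar> = \<epsilon> * (v - u)"
        using eps \<open>u \<le> v\<close> by (simp flip: right_diff_distrib)
      ultimately show "dist (h v + \<epsilon> * v) (h u + \<epsilon> * u)
          \<le> B * dist (y v) (y u) + (B * K + \<epsilon>) * (v - u)"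
        unfolding dist_real_def distrib_right by linarith
    qed
    from good show "AE t in lebesgue. a < t \<and> t < b \<longrightarrow>
      (\<forall>e>0. \<exists>d>0. \<forall>u v. a \<le> u \<and> u \<le> t \<and> t \<le> v \<and> v \<le> b \<and> v - u < d \<longrightarrow>
        h v + \<epsilon> * v - (h u + \<epsilon> * u) \<le> e * (v - u))"
    proof eventually_elim
      fix t
      assume gt: "0 \<le> t \<and> t \<le> \<tau> \<and> h t \<noteq> 0 \<longrightarrow>
        (\<exists>D. (w has_vector_derivative D) (at t) \<and>
          (w t - closest_point G (w t)) \<bullet> D \<le> - \<epsilon> * dist (w t) (closest_point G (w t)))"
      show "a < t \<and> t < b \<longrightarrow>
        (\<forall>e>0. \<exists>d>0. \<forall>u v. a \<le> u \<and> u \<le> t \<and> t \<le> v \<and> v \<le> b \<and> v - u < d \<longrightarrow>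
          h v + \<epsilon> * v - (h u + \<epsilon> * u) \<le> e * (v - u))"
      proof (intro impI allI)
        fix e :: real assume t: "a < t \<and> t < b" and "e > 0"
        then have "h t \<noteq> 0" using pos by blast
        then obtain D where D: "(w has_vector_derivative D) (at t)"
            "(w t - closest_point G (w t)) \<bullet> D \<le> - \<epsilon> * dist (w t) (closest_point G (w t))"
          using gt t ab by auto
        have "w t \<noteq> closest_point G (w t)" using \<open>h t \<noteq> 0\<close> by (auto simp: h_def)
        from dist_closest_point_straddle[OF G D(1) this D(2) \<open>e > 0\<close>]
        obtain d where "d > 0" and d: "\<And>u v. u \<le> t \<Longrightarrow> t \<le> v \<Longrightarrow> v - u < d \<Longrightarrow>
            h v - h u \<le> (- \<epsilon> + e) * (v - u)"
          unfolding h_def by blast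
        have "h v + \<epsilon> * v - (h u + \<epsilon> * u) \<le> e * (v - u)" if "u \<le> t" "t \<le> v" "v - u < d" for u v
          using d[OF that] by (simp add: algebra_simps)
        then show "\<exists>d>0. \<forall>u v. a \<le> u \<and> u \<le> t \<and> t \<le> v \<and> v \<le> b \<and> v - u < d \<longrightarrow>
          h v + \<epsilon> * v - (h u + \<epsilon> * u) \<le> e * (v - u)"
          using \<open>d > 0\<close> by blast
      qed
    qed
  qed

  \<comment> \<open>Arrival in \<open>F\<close> by time \<open>\<tau>\<close>\<close>
  have h0: "h 0 \<le> \<epsilon> * \<tau>"
  proof -
    \<comment> \<open>One vertex suffices: the distance to \<open>F\<close> is at most the distance
      to \<open>ystar 1\<close>, and \<open>\<epsilon> * \<tau>\<close> dominates the latter on all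
      of \<open>C\<close>.\<close>
    have "S (ystar 1) \<in> G" using Y[of 1] M by (simp add: G_def)
    then have "h 0 \<le> dist (w 0) (S (ystar 1))"
      unfolding h_def using G(2) by (intro closest_point_le)
    also have "\<dots> = normA A (z 0 - ystar 1)" by (simp add: norm_S w_def dist_norm S_diff)
    also have "\<dots> \<le> (SUP (v, i)\<in>C \<times> {1..M}. normA A (v - ystar i))"
      using normA_bdd_above[OF A_diag A_pos \<open>bounded C\<close>, of "{1..M}" ystar] zC[of 0] M
      by (intro cSUP_upper2[where x="(z 0, 1)"]) auto
    also have "\<dots> = \<epsilon> * \<tau>" using eps by (simp add: \<tau>_def tau_d_def)
    finally show ?thesis .
  qed
  have "\<tau> \<ge> 0"
    using order_trans[OF h_nonneg[of 0] h0] eps by (simp add: zero_le_mult_iff)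

  \<comment> \<open>Without a zero, the decay over the whole interval uses up the initial distance.
    Otherwise \<open>h\<close> might leave zero again, which is ruled out by starting the decay at
    its last zero.\<close>
  have "h \<tau> = 0"
  proof (cases "\<exists>t\<in>{0..\<tau>}. h t = 0")
    case False
    then have "h \<tau> + \<epsilon> * \<tau> \<le> h 0 + \<epsilon> * 0"
      using \<open>\<tau> \<ge> 0\<close> by (intro decay) auto
    then show ?thesis using h0 h_nonneg[of \<tau>] by simp
  next
    case True
    define Z where "Z = {t \<in> {0..\<tau>}. h t = 0}"
    have "absolutely_cont_on {0..\<tau>} h"
      by (rule absolutely_cont_on_le[OF y_ac, of 0 _ h B "B * K"])
        (use h_inc in \<open>auto simp: dist_real_def\<close>)
    then have "continuous_on {0..\<tau>} h" by (rule absolutely_cont_on_imp_continuous_on)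
    then have "closed Z"
      unfolding Z_def by (intro continuous_closed_preimage_constant) auto
    moreover have "Z \<noteq> {}" "bdd_above Z" using True by (auto simp: Z_def bdd_above_def)
    ultimately have s: "Sup Z \<in> Z" and top: "\<And>t. t \<in> Z \<Longrightarrow> t \<le> Sup Z"
      by (auto intro: closed_contains_Sup cSup_upper)
    \<comment> \<open>Starting from the value 0, decay over a positive time would make
      \<open>h \<tau>\<close> negative.\<close>
    have "h \<tau> + \<epsilon> * \<tau> \<le> h (Sup Z) + \<epsilon> * Sup Z"
    proof (rule decay)
      fix t assume "Sup Z < t" "t < \<tau>"
      then show "h t \<noteq> 0" using top[of t] s by (auto simp: Z_def)
    qed (use s in \<open>auto simp: Z_def\<close>)
    moreover have "\<epsilon> * Sup Z \<le> \<epsilon> * \<tau>" using s eps by (auto simp: Z_def)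
    moreover have "h (Sup Z) = 0" using s by (simp add: Z_def)
    ultimately show ?thesis using h_nonneg[of \<tau>] by linarith
  qed
  then have "w \<tau> \<in> S ` F"
    using closest_point_in_set[OF G(2,3), of "w \<tau>"] by (simp add: h_def G_def)
  then have "z \<tau> \<in> F" using S(2) by (auto simp: w_def inj_def)
  then have "y \<tau> \<in> translate_by F c \<tau>"
    by (auto simp: translate_by_def z_def intro!: image_eqI[of _ _ "y \<tau> - c \<tau>"])
  then show ?thesis by (simp add: \<tau>_def F_def C_def)
qed

end
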